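(* Let $\alpha\in\mathbb N_0^4$ and $\gamma\in\mathbb N_0^3$ be such that $\mathcal S_\gamma^\alpha$ is finite, and assume $\alpha_0\ge1$. Suppose that $$\gamma_i+\gamma_j=\alpha_0+\alpha_i+\alpha_j+2\qquad\text{for all }1\le i<j\le3.$$ Then $$\mathcal S_\gamma^\alpha=\frac13\sum_{1\le i<j\le3}\mathcal S_{\gamma-\mathbf e_i-\mathbf e_j}^{\alpha-\mathbf e_0}+\frac16\sum_{\substack{1\le i,j\le3\\i\ne j}}\mathcal S_{\gamma-\mathbf e_j}^{\alpha-\mathbf e_0+\mathbf e_i}-\frac23\sum_{1\le i<j\le3}\mathcal S_\gamma^{\alpha-\mathbf e_0+\mathbf e_i+\mathbf e_j},$$ and all moments on the right-hand side are finite.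
   Context: Let $T\subset\mathbb R^3$ be a tetrahedron with barycentric coordinates $\lambda_0,\dots,\lambda_3$. For $\alpha=(\alpha_0,\alpha_1,\alpha_2,\alpha_3)\in\mathbb N_0^4$ and $\gamma=(\gamma_1,\gamma_2,\gamma_3)\in\mathbb N_0^3$ the star moment is $$\mathcal S_\gamma^\alpha=|T|^{-1}\int_T\frac{\lambda_0^{\alpha_0}\lambda_1^{\alpha_1}\lambda_2^{\alpha_2}\lambda_3^{\alpha_3}}{(\lambda_0+\lambda_1)^{\gamma_1}(\lambda_0+\lambda_2)^{\gamma_2}(\lambda_0+\lambda_3)^{\gamma_3}}\,\mathrm dx\in[0,\infty].$$ In upper indices $\mathbf e_0,\dots,\mathbf e_3$ are the canonical unit vectors of $\mathbb N_0^4$ (indexed from $0$); in lower indices $\mathbf e_1,\mathbf e_2,\mathbf e_3$ are the canonical unit vectors of $\mathbb N_0^3$. The middle sum is over ordered pairs $(i,j)$ with $i\neq j$. *)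

theory Defs
  imports "HOL-Analysis.Analysis" "HOL-Library.Function_Algebras"
begin

text \<open>
  Indexed families are functions on \<^typ>\<open>nat\<close> of which only finitely many values are ever used:
  vertices \<open>v\<close> and upper multi-indices \<open>\<alpha>\<close> are read at \<open>0, 1, 2, 3\<close>, lower multi-indices \<open>\<gamma>\<close>
  at \<open>1, 2, 3\<close>. Sums and differences of multi-indices are the pointwise ones.
\<close>

definition tetrahedron_vertices :: "(nat \<Rightarrow> real^3) \<Rightarrow> bool" where
  "tetrahedron_vertices v \<longleftrightarrow> inj_on v {0..3} \<and> \<not> affine_dependent (v ` {0..3})"

definition tetrahedron :: "(nat \<Rightarrow> real^3) \<Rightarrow> (real^3) set" where
  "tetrahedron v = convex hull (v ` {0..3})"

text \<open>
  The weights \<open>w\<close> are unique only on \<open>{0..3}\<close>, so the description is of the single number \<open>w i\<close>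
  (with \<open>i \<le> 3\<close>) rather than of the function \<open>w\<close>.
\<close>

definition bary :: "(nat \<Rightarrow> real^3) \<Rightarrow> nat \<Rightarrow> real^3 \<Rightarrow> real" where
  "bary v i x = (THE c. \<exists>w. (\<Sum>k=0..3. w k) = 1 \<and> (\<Sum>k=0..3. w k *\<^sub>R v k) = x \<and> w i = c)"

text \<open>
  The integral is taken in \<open>[0,\<infinity>]\<close>. A denominator can vanish on the tetrahedron only on
  an edge, which is a null set, so the convention \<open>a / 0 = 0\<close> does not affect the value.
\<close>

definition star_moment ::
    "(nat \<Rightarrow> real^3) \<Rightarrow> (nat \<Rightarrow> nat) \<Rightarrow> (nat \<Rightarrow> nat) \<Rightarrow> ennreal" where
  "star_moment v \<alpha> \<gamma> =
     (\<integral>\<^sup>+x\<in>tetrahedron v.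
        ennreal ((\<Prod>k=0..3. bary v k x ^ \<alpha> k) /
                 (\<Prod>k=1..3. (bary v 0 x + bary v k x) ^ \<gamma> k)) \<partial>lborel)
     / emeasure lborel (tetrahedron v)"

definition eunit :: "nat \<Rightarrow> nat \<Rightarrow> nat" where
  "eunit i = (\<lambda>k. if k = i then 1 else 0)"

end

theory Submission
  imports Defs
begin

text \<open>
  The pairwise conditions on the exponents have the solution
  \<open>\<alpha> 0 = 2 * n + 2\<close> and \<open>\<gamma> k = \<alpha> k + n + 2\<close> (lemma \<open>exponents_from_pair_sums\<close>), so \<open>\<alpha> 0\<close> is even
  and at least \<open>2\<close>. With this the theorem splits into an algebraic and an analytic half.
  
  The algebraic half is that the identity already holds between the integrands, at every point of
  the tetrahedron (lemma \<open>star_integrand_relation\<close>). Let \<open>P\<close> be the integrand with exponents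
  \<open>\<alpha> - eunit 0\<close> and \<open>\<gamma>\<close>, and \<open>s k = l 0 + l k\<close>, where \<open>l\<close> are the barycentric coordinates. Then the
  integrand on the left is \<open>l 0 * P\<close>, and those on the right are \<open>s i * s j * P\<close>, \<open>l i * s j * P\<close>
  and \<open>l i * l j * P\<close>. If \<open>\<sigma>\<close> is the sum and \<open>e\<close> the second elementary symmetric polynomial of
  \<open>l 1, l 2, l 3\<close>, then the three sums on the right are \<open>P\<close> times \<open>3 * (l 0)^2 + 2 * l 0 * \<sigma> + e\<close>,
  \<open>2 * l 0 * \<sigma> + 2 * e\<close> and \<open>e\<close>, and with the weights \<open>1/3\<close>, \<open>1/6\<close>, \<open>- 2/3\<close> they add up to
  \<open>P * l 0 * (l 0 + \<sigma>)\<close>. As \<open>l 0 + \<sigma> = 1\<close>, this is \<open>P * l 0\<close>. On the face \<open>l 0 = 0\<close>, where the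
  division by \<open>s k\<close> may be meaningless, all integrands carry a positive power of \<open>l 0\<close> and vanish.
  
  The analytic half is the finiteness of the moments on the right. By \<open>l k \<le> s k\<close> every integrand
  there is at most some \<open>s i * s j * P\<close>, hence at most a star monomial in \<open>l 0, s 1, s 2, s 3\<close>. The
  \<open>s k\<close> add up to at least \<open>1\<close>, so one of them is at least \<open>1/3\<close>, and the monomial is bounded by
  a constant times the sum of the three functions \<open>1 / (s i * s j)\<close> (lemma \<open>star_monomial_le\<close>).
  These are integrable: \<open>1 / ((x + y) * (x + z)) \<le> (x * y * z) powr (-2/3)\<close>, a product of
  one-variable functions that are integrable over the unit interval, and an affine change of
  variables takes \<open>l 0, l i, l j\<close> to the coordinates of the unit cube
  (lemma \<open>integrable_tetrahedron_inverse_two_sums\<close>).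
\<close>

section \<open>Barycentric coordinates\<close>

text \<open>
  Every fact about \<^const>\<open>bary\<close> is read off from some explicit weights through this rule. Two
  weight vectors of the same point differ by an affine dependency of the vertices, which is trivial;
  injectivity of \<open>v\<close> turns it from a function of the vertices into one of the indices.
\<close>

lemma bary_eqI:
  assumes v: "tetrahedron_vertices v" and i: "i \<in> {0..3}"
    and w: "(\<Sum>k=0..3. w k) = 1" "(\<Sum>k=0..3. w k *\<^sub>R v k) = x"
  shows "bary v i x = w i"
  unfolding bary_def
proof (rule the_equality)
  show "\<exists>w'. (\<Sum>k=0..3. w' k) = 1 \<and> (\<Sum>k=0..3. w' k *\<^sub>R v k) = x \<and> w' i = w i"
    using w by blast
next
  fix c
  assume "\<exists>w'. (\<Sum>k=0..3. w' k) = 1 \<and> (\<Sum>k=0..3. w' k *\<^sub>R v k) = x \<and> w' i = c"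
  then obtain w' where w': "(\<Sum>k=0..3. w' k) = 1" "(\<Sum>k=0..3. w' k *\<^sub>R v k) = x" "w' i = c"
    by blast
  have inj: "inj_on v {0..3}" and indep: "\<not> affine_dependent (v ` {0..3})"
    using v by (auto simp: tetrahedron_vertices_def)
  define U where "U = (\<lambda>y. w' (inv_into {0..3} v y) - w (inv_into {0..3} v y))"
  have U: "U (v k) = w' k - w k" if "k \<in> {0..3}" for k
    using inj that by (simp add: U_def inv_into_f_f)
  have "sum U (v ` {0..3}) = (\<Sum>k=0..3. w' k - w k)"
    by (subst sum.reindex[OF inj]) (auto simp: U intro!: sum.cong)
  then have "sum U (v ` {0..3}) = 0"
    using w w' by (simp add: sum_subtractf)
  moreover have "(\<Sum>y\<in>v ` {0..3}. U y *\<^sub>R y) = (\<Sum>k=0..3. w' k *\<^sub>R v k - w k *\<^sub>R v k)"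
    by (subst sum.reindex[OF inj]) (auto simp: U algebra_simps intro!: sum.cong)
  then have "(\<Sum>y\<in>v ` {0..3}. U y *\<^sub>R y) = 0"
    using w w' by (simp add: sum_subtractf)
  ultimately have "U (v i) = 0"
    using indep i affine_dependent_explicit_finite[of "v ` {0..3}"] by blast
  then show "c = w i"
    using U[OF i] w' by simp
qed

text \<open>
  Four affinely independent points of a space of dimension three span all of it, so barycentric
  coordinates exist outside the tetrahedron as well.
\<close>

lemma
  assumes v: "tetrahedron_vertices v"
  shows sum_bary: "(\<Sum>k=0..3. bary v k x) = 1"
    and sum_bary_scaleR: "(\<Sum>k=0..3. bary v k x *\<^sub>R v k) = x"
proof -
  have inj: "inj_on v {0..3}" and indep: "\<not> affine_dependent (v ` {0..3})"
    using v by (auto simp: tetrahedron_vertices_def)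
  have "card (v ` {0..3}) = Suc DIM(real^3)"
    using inj by (simp add: card_image)
  then have "affine hull (v ` {0..3}) = UNIV"
    using indep affine_independent_span_eq by blast
  then have "x \<in> {y. \<exists>u. sum u (v ` {0..3}) = 1 \<and> (\<Sum>z\<in>v ` {0..3}. u z *\<^sub>R z) = y}"
    by (subst affine_hull_finite[symmetric]) auto
  then obtain u where "sum u (v ` {0..3}) = 1" "(\<Sum>z\<in>v ` {0..3}. u z *\<^sub>R z) = x"
    by blast
  then have w: "(\<Sum>k=0..3. u (v k)) = 1" "(\<Sum>k=0..3. u (v k) *\<^sub>R v k) = x"
    by (simp_all add: sum.reindex[OF inj])
  have b: "bary v k x = u (v k)" if "k \<in> {0..3}" for k
    using bary_eqI[OF v that w] .
  show "(\<Sum>k=0..3. bary v k x) = 1" "(\<Sum>k=0..3. bary v k x *\<^sub>R v k) = x"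
    unfolding w[symmetric] by (intro sum.cong; simp add: b w)+
qed

lemma linear_bary:
  assumes v: "tetrahedron_vertices v" and i: "i \<in> {0..3}"
  shows "linear (\<lambda>x. bary v i x - bary v i 0)"
proof (rule linearI)
  fix x y
  have "bary v i (x + y) = bary v i x + bary v i y - bary v i 0"
    by (rule bary_eqI[OF v i])
      (simp_all add: algebra_simps sum.distrib sum_subtractf sum_bary[OF v] sum_bary_scaleR[OF v])
  then show "bary v i (x + y) - bary v i 0 = bary v i x - bary v i 0 + (bary v i y - bary v i 0)"
    by simp
next
  fix r x
  have "bary v i (r *\<^sub>R x) = r * bary v i x + (1 - r) * bary v i 0"
  proof (rule bary_eqI[OF v i])
    show "(\<Sum>k=0..3. r * bary v k x + (1 - r) * bary v k 0) = 1"
      by (simp only: sum.distrib sum_distrib_left[symmetric] sum_bary[OF v]) simp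
    have "(\<Sum>k=0..3. (r * bary v k x + (1 - r) * bary v k 0) *\<^sub>R v k) =
        r *\<^sub>R (\<Sum>k=0..3. bary v k x *\<^sub>R v k) + (1 - r) *\<^sub>R (\<Sum>k=0..3. bary v k 0 *\<^sub>R v k)"
      by (simp only: sum.distrib scaleR_sum_right scaleR_left_distrib scaleR_scaleR)
    then show "(\<Sum>k=0..3. (r * bary v k x + (1 - r) * bary v k 0) *\<^sub>R v k) = r *\<^sub>R x"
      by (simp add: sum_bary_scaleR[OF v])
  qed
  then show "bary v i (r *\<^sub>R x) - bary v i 0 = r *\<^sub>R (bary v i x - bary v i 0)"
    by (simp add: algebra_simps)
qed

lemma continuous_on_bary:
  assumes "tetrahedron_vertices v" and "i \<in> {0..3}"
  shows "continuous_on S (bary v i)"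
proof -
  have "continuous_on S (\<lambda>x. (bary v i x - bary v i 0) + bary v i 0)"
    by (intro continuous_on_add continuous_on_const linear_continuous_on
        linear_conv_bounded_linear[THEN iffD1] linear_bary assms)
  then show ?thesis
    by simp
qed

lemma tetrahedron_eq:
  assumes v: "tetrahedron_vertices v"
  shows "tetrahedron v = {x. \<forall>i\<in>{0..3}. 0 \<le> bary v i x}"
proof -
  have inj: "inj_on v {0..3}"
    using v by (simp add: tetrahedron_vertices_def)
  show ?thesis
  proof (intro set_eqI iffI)
    fix x assume "x \<in> tetrahedron v"
    then obtain u where u: "\<forall>y\<in>v ` {0..3}. 0 \<le> u y" "sum u (v ` {0..3}) = 1"
        "(\<Sum>z\<in>v ` {0..3}. u z *\<^sub>R z) = x"
      unfolding tetrahedron_def by (subst (asm) convex_hull_finite) auto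
    then have w: "(\<Sum>k=0..3. u (v k)) = 1" "(\<Sum>k=0..3. u (v k) *\<^sub>R v k) = x"
      by (simp_all add: sum.reindex[OF inj])
    show "x \<in> {x. \<forall>i\<in>{0..3}. 0 \<le> bary v i x}"
      using u(1) bary_eqI[OF v _ w] by auto
  next
    fix x assume x: "x \<in> {x. \<forall>i\<in>{0..3}. 0 \<le> bary v i x}"
    have "(\<Sum>k=0..3. bary v k x *\<^sub>R v k) \<in> convex hull (v ` {0..3})"
      by (intro convex_sum) (use x in \<open>auto simp: sum_bary[OF v] hull_inc\<close>)
    then show "x \<in> tetrahedron v"
      by (simp add: tetrahedron_def sum_bary_scaleR[OF v])
  qed
qed

lemma compact_tetrahedron: "compact (tetrahedron v)"
  unfolding tetrahedron_def by (intro compact_convex_hull finite_imp_compact) auto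

text \<open>
  The volume is positive because the points with positive coordinates form an open set, which
  contains the centroid.
\<close>

lemma emeasure_tetrahedron:
  assumes v: "tetrahedron_vertices v"
  shows "emeasure lborel (tetrahedron v) \<noteq> 0" "emeasure lborel (tetrahedron v) < \<infinity>"
proof -
  show "emeasure lborel (tetrahedron v) < \<infinity>"
    by (rule emeasure_compact_finite[OF compact_tetrahedron])
  define U where "U = (\<Inter>i\<in>{0..3}. {x. 0 < bary v i x})"
  have "open U"
    unfolding U_def
    by (intro open_INT finite_atLeastAtMost ballI open_Collect_less continuous_on_const
        continuous_on_bary v)
  moreover have "(\<Sum>k=0..3. (1/4) *\<^sub>R v k) \<in> U"
  proof -
    have "bary v i (\<Sum>k=0..3. (1/4) *\<^sub>R v k) = 1/4" if "i \<in> {0..3}" for i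
      by (rule bary_eqI[OF v that]) auto
    then have "0 < bary v i (\<Sum>k=0..3. (1/4) *\<^sub>R v k)" if "i \<in> {0..3}" for i
      using that by force
    then show ?thesis
      unfolding U_def by blast
  qed
  ultimately have "\<not> negligible U"
    using open_not_negligible by blast
  moreover have "U \<subseteq> tetrahedron v"
    by (auto simp: U_def tetrahedron_eq[OF v] less_imp_le)
  ultimately have "\<not> negligible (tetrahedron v)"
    using negligible_subset by blast
  then show "emeasure lborel (tetrahedron v) \<noteq> 0"
    using compact_tetrahedron[of v]
    by (auto simp: negligible_iff_null_sets null_sets_def borel_compact)
qed

section \<open>An integrable singularity along two edges\<close>

lemma nn_integral_powr_two_thirds:
  "(\<integral>\<^sup>+t. ennreal (indicator {0..1} t * t powr (-2/3)) \<partial>lborel) < \<infinity>"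
proof -
  have "((\<lambda>t::real. t powr (-2/3)) has_integral 3) {0..1}"
    using has_integral_powr_from_0[of "-2/3" 1] by simp
  then have "(\<integral>\<^sup>+t. ennreal (indicator {0..1} t * t powr (-2/3)) \<partial>lborel) = ennreal 3"
    using nn_integral_has_integral_lebesgue[of "{0..1}" "\<lambda>t::real. t powr (-2/3)" 3]
    by (simp add: mult.commute)
  then show ?thesis
    by simp
qed

text \<open>
  Weighted form of \<open>x \<le> x + y\<close> and \<open>y \<le> x + y\<close>; the weights are chosen for the next lemma.
\<close>

lemma inverse_sum_le_powr:
  fixes x y :: real
  assumes "0 < x" "0 < y"
  shows "1 / (x + y) \<le> x powr (-1/3) * y powr (-2/3)"
proof -
  have "x powr (1/3) * y powr (2/3) \<le> (x + y) powr (1/3) * (x + y) powr (2/3)"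
    using assms by (intro mult_mono powr_mono2) auto
  also have "\<dots> = x + y"
    using assms by (simp flip: powr_add)
  finally have "1 / (x + y) \<le> 1 / (x powr (1/3) * y powr (2/3))"
    using assms by (intro divide_left_mono) auto
  also have "\<dots> = x powr (-1/3) * y powr (-2/3)"
    by (simp add: powr_minus_divide)
  finally show ?thesis .
qed

text \<open>
  The singularity has degree \<open>-2\<close>. Spread evenly over the three variables it leaves each of them
  the exponent \<open>-2/3\<close>, which is integrable at \<open>0\<close>.
\<close>

lemma inverse_two_sums_le:
  fixes x y z :: real
  assumes "0 < x" "0 < y" "0 < z"
  shows "1 / ((x + y) * (x + z)) \<le> x powr (-2/3) * (y powr (-2/3) * z powr (-2/3))"
proof -
  have "1 / (x + y) * (1 / (x + z)) \<le>
      (x powr (-1/3) * y powr (-2/3)) * (x powr (-1/3) * z powr (-2/3))"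
    using assms by (intro mult_mono inverse_sum_le_powr) auto
  also have "\<dots> = (x powr (-1/3) * x powr (-1/3)) * (y powr (-2/3) * z powr (-2/3))"
    by (simp add: mult_ac)
  also have "x powr (-1/3) * x powr (-1/3) = x powr (-2/3)"
    by (simp flip: powr_add)
  finally show ?thesis
    by simp
qed

lemma integrable_cube_inverse_two_sums:
  "integrable lborel
     (\<lambda>u::real^3. indicator (cbox 0 1) u * (1 / ((u$1 + u$2) * (u$1 + u$3))))"
proof (rule integrableI_bounded)
  let ?f = "\<lambda>u::real^3. indicator (cbox 0 1) u * (1 / ((u$1 + u$2) * (u$1 + u$3)))"
  show "?f \<in> borel_measurable lborel"
    by measurable
  define \<phi> where "\<phi> = (\<lambda>t::real. ennreal (indicator {0..1} t * t powr (-2/3)))"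
  have \<phi>[measurable]: "\<phi> \<in> borel_measurable borel"
    unfolding \<phi>_def by measurable
  have prod: "(\<Prod>b\<in>Basis. \<phi> (u \<bullet> b)) = \<phi> (u$1) * (\<phi> (u$2) * \<phi> (u$3))" for u :: "real^3"
  proof -
    have "(\<Prod>b\<in>Basis. \<phi> (u \<bullet> b)) = (\<Prod>i\<in>UNIV. \<phi> (u $ i))"
      unfolding Basis_vec_def
      by (subst prod.reindex_bij_betw[of "\<lambda>i. axis i 1" UNIV, symmetric])
        (auto simp: bij_betw_def inj_on_def axis_eq_axis inner_axis)
    also have "\<dots> = \<phi> (u$1) * (\<phi> (u$2) * \<phi> (u$3))"
      unfolding UNIV_3 by simp
    finally show ?thesis .
  qed
  \<comment> \<open>Where a coordinate vanishes the bounding product is \<open>0\<close>, by the value of \<open>0 powr a\<close>, and the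
      bound fails; so these planes have to be discarded.\<close>
  have null: "{u::real^3. u $ i = 0} \<in> null_sets lborel" for i
  proof -
    have "negligible {u::real^3. u $ i = 0}"
      by (rule negligible_standard_hyperplane_cart)
    moreover have "{u::real^3. u $ i = 0} \<in> sets lborel"
      by measurable
    ultimately show ?thesis
      by (simp add: negligible_iff_null_sets null_sets_completion_iff)
  qed
  have "AE u::real^3 in lborel. u $ i \<noteq> 0" for i
    using AE_not_in[OF null[of i]] by simp
  then have ae: "AE u::real^3 in lborel. u$1 \<noteq> 0 \<and> u$2 \<noteq> 0 \<and> u$3 \<noteq> 0"
    by simp
  have "AE u in lborel. ennreal (norm (?f u)) \<le> (\<Prod>b\<in>Basis. \<phi> (u \<bullet> b))"
    using ae
  proof eventually_elim
    case (elim u)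
    show ?case
    proof (cases "u \<in> cbox 0 1")
      case True
      then have u: "0 \<le> u $ i" "u $ i \<le> 1" for i
        by (auto simp: mem_box_cart)
      then have pos: "0 < u $ 1" "0 < u $ 2" "0 < u $ 3"
        using elim by (auto simp: less_le)
      have "ennreal (norm (?f u)) \<le>
          ennreal ((u$1) powr (-2/3) * ((u$2) powr (-2/3) * (u$3) powr (-2/3)))"
        using inverse_two_sums_le[OF pos] True pos by (intro ennreal_leI) simp
      also have "\<dots> = \<phi> (u$1) * (\<phi> (u$2) * \<phi> (u$3))"
        using u by (simp add: \<phi>_def ennreal_mult)
      finally show ?thesis
        by (simp only: prod)
    qed simp
  qed
  then have "(\<integral>\<^sup>+u. ennreal (norm (?f u)) \<partial>lborel) \<le>
      (\<integral>\<^sup>+(u::real^3). (\<Prod>b\<in>Basis. \<phi> (u \<bullet> b)) \<partial>lborel)"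
    by (rule nn_integral_mono_AE)
  also have "\<dots> = (\<Prod>b\<in>(Basis :: (real^3) set). \<integral>\<^sup>+t. \<phi> t \<partial>lborel)"
    by (rule nn_integral_lborel_prod) auto
  also have "\<dots> < \<infinity>"
    using nn_integral_powr_two_thirds
    by (simp add: \<phi>_def power_less_top_ennreal)
  finally show "(\<integral>\<^sup>+u. ennreal (norm (?f u)) \<partial>lborel) < \<infinity>" .
qed

text \<open>
  The general change of variables has the constant Jacobian \<open>det (matrix L)\<close> here, which is not
  \<open>0\<close> and can be divided out.
\<close>

lemma integrable_lborel_affine_cart:
  fixes f :: "real^'n::{finite,wellorder} \<Rightarrow> real" and L :: "real^'n::_ \<Rightarrow> real^'n::_"
  assumes f: "integrable lborel f" and L: "linear L" "inj L"
  shows "integrable lborel (\<lambda>x. f (c + L x))"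
proof -
  \<comment> \<open>The change of variables is for vector-valued functions, so \<open>f\<close> is viewed as a function into
      \<open>real^1\<close>.\<close>
  define e :: "real^1" where "e = axis 1 1"
  have e: "e \<bullet> e = 1"
    by (simp add: e_def inner_axis_axis)
  let ?F = "\<lambda>u. f u *\<^sub>R e"
  have fb[measurable]: "f \<in> borel_measurable borel"
    using f by (simp add: integrable_iff_bounded)
  have meas[measurable]: "(\<lambda>x. f (c + L x)) \<in> borel_measurable borel"
    using L(1) by (intro measurable_compose[OF _ fb] borel_measurable_continuous_onI
        continuous_intros linear_continuous_on linear_conv_bounded_linear[THEN iffD1])
  have surj: "range (\<lambda>x. c + L x) = UNIV"
  proof -
    have "surj L"
      using L linear_injective_imp_surjective by blast
    then have "\<exists>x. L x = u - c" for u
      by (metis surjD)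
    then have "\<exists>x. u = c + L x" for u
      by (metis add.commute diff_add_cancel)
    then show ?thesis
      by auto
  qed
  have "integrable lebesgue f"
    using f by (simp add: integrable_completion)
  then have "f absolutely_integrable_on UNIV"
    by (simp add: set_integrable_def)
  then have "?F absolutely_integrable_on ((\<lambda>x. c + L x) ` UNIV)"
    unfolding surj by (intro set_integrable_scaleR_left)
  then have "(\<lambda>x. \<bar>det (matrix L)\<bar> *\<^sub>R ?F (c + L x)) absolutely_integrable_on UNIV"
  proof (subst (asm) absolutely_integrable_change_of_variables[where g' = "\<lambda>_. L"])
    show "((\<lambda>x. c + L x) has_derivative L) (at x)" for x
      using L(1) by (auto intro!: derivative_eq_intros bounded_linear_imp_has_derivative
          simp: linear_conv_bounded_linear)
    show "inj (\<lambda>x. c + L x)"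
      using L(2) by (simp add: inj_def)
  qed auto
  then have "(\<lambda>x. ?F (c + L x)) absolutely_integrable_on UNIV"
    using det_nz_iff_inj[OF L(1)] L(2)
    by (simp add: absolutely_integrable_on_scaleR_iff del: scaleR_scaleR)
  then have "(\<lambda>x. ?F (c + L x) \<bullet> e) absolutely_integrable_on UNIV"
    by (rule absolutely_integrable_component)
  then have "(\<lambda>x. f (c + L x)) absolutely_integrable_on UNIV"
    by (simp add: e)
  then show ?thesis
    by (simp add: set_integrable_def integrable_completion)
qed

text \<open>
  The coordinates with indices \<open>0\<close>, \<open>i\<close>, \<open>j\<close> determine the remaining one, since all four add up
  to \<open>1\<close>; so they form an injective affine map, and it sends the tetrahedron into the unit cube.
\<close>

lemma integrable_tetrahedron_inverse_two_sums:
  assumes v: "tetrahedron_vertices v" and ij: "i \<in> {1..3}" "j \<in> {1..3}" "i \<noteq> j"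
  shows "set_integrable lborel (tetrahedron v)
    (\<lambda>x. 1 / ((bary v 0 x + bary v i x) * (bary v 0 x + bary v j x)))"
proof -
  let ?f = "\<lambda>u::real^3. indicator (cbox 0 1) u * (1 / ((u$1 + u$2) * (u$1 + u$3)))"
  define c :: "real^3" where "c = vector [bary v 0 0, bary v i 0, bary v j 0]"
  define L :: "real^3 \<Rightarrow> real^3" where
    "L = (\<lambda>x. vector [bary v 0 x - bary v 0 0, bary v i x - bary v i 0, bary v j x - bary v j 0])"
  have cL: "c + L x = vector [bary v 0 x, bary v i x, bary v j x]" for x
    by (simp add: c_def L_def vec_eq_iff forall_3)
  have lin: "linear (\<lambda>x. bary v k x - bary v k 0)" if "k \<in> {0, i, j}" for k
    using linear_bary[OF v, of k] that ij by auto
  have "linear L"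
    using lin[of 0] lin[of i] lin[of j]
    by (simp add: linear_iff L_def vec_eq_iff forall_3)
  moreover have "inj L"
  proof (rule injI)
    fix x y assume "L x = L y"
    then have "c + L x = c + L y"
      by simp
    then have eq: "bary v k x = bary v k y" if "k \<in> {0, i, j}" for k
      using that by (auto simp: cL vec_eq_iff forall_3)
    obtain l where l: "{0..3} = {0, i, j, l}" "l \<notin> {0, i, j}"
    proof (rule that)
      have "i = 1 \<or> i = 2 \<or> i = 3" "j = 1 \<or> j = 2 \<or> j = 3"
        using ij by auto
      then show "{0..3} = {0, i, j, 6 - i - j}" "6 - i - j \<notin> {0, i, j}"
        using ij(3) by (elim disjE; fastforce)+
    qed
    have "bary v l x = bary v l y"
      using sum_bary[OF v, of x] sum_bary[OF v, of y] eq ij l by auto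
    then have "bary v k x = bary v k y" if "k \<in> {0..3}" for k
      using eq l that by auto
    then have "(\<Sum>k=0..3. bary v k x *\<^sub>R v k) = (\<Sum>k=0..3. bary v k y *\<^sub>R v k)"
      by (intro sum.cong) auto
    then show "x = y"
      by (simp only: sum_bary_scaleR[OF v])
  qed
  ultimately have "integrable lborel (\<lambda>x. ?f (c + L x))"
    by (rule integrable_lborel_affine_cart[OF integrable_cube_inverse_two_sums])
  then have "set_integrable lborel (tetrahedron v) (\<lambda>x. ?f (c + L x))"
    unfolding set_integrable_def using compact_tetrahedron[of v]
    by (intro integrable_mult_indicator) (auto simp: borel_compact)
  moreover have "c + L x \<in> cbox 0 1" if "x \<in> tetrahedron v" for x
  proof -
    have b: "0 \<le> bary v k x" if "k \<in> {0..3}" for k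
      using \<open>x \<in> tetrahedron v\<close> that by (simp add: tetrahedron_eq[OF v])
    have "bary v k x \<le> 1" if "k \<in> {0..3}" for k
      using member_le_sum[of k "{0..3}" "\<lambda>k. bary v k x"] b that
      by (simp only: sum_bary[OF v]) auto
    then show ?thesis
      using b ij by (simp add: cL mem_box_cart forall_3)
  qed
  ultimately show ?thesis
    by (subst set_integrable_cong[OF refl refl]) (auto simp: cL)
qed

section \<open>The integrand of a star moment\<close>

definition star_integrand :: "(nat \<Rightarrow> real) \<Rightarrow> (nat \<Rightarrow> nat) \<Rightarrow> (nat \<Rightarrow> nat) \<Rightarrow> real" where
  "star_integrand l \<alpha> \<gamma> = (\<Prod>k=0..3. l k ^ \<alpha> k) / (\<Prod>k=1..3. (l 0 + l k) ^ \<gamma> k)"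

lemma star_integrand_nonneg:
  assumes "\<And>k. k \<in> {0..3} \<Longrightarrow> 0 \<le> l k"
  shows "0 \<le> star_integrand l \<alpha> \<gamma>"
  unfolding star_integrand_def
  by (intro divide_nonneg_nonneg prod_nonneg zero_le_power add_nonneg_nonneg ballI)
    (use assms in auto)

lemma star_integrand_eq_0:
  assumes "l 0 = 0" "\<alpha> 0 \<ge> 1"
  shows "star_integrand l \<alpha> \<gamma> = 0"
proof -
  have "(\<Prod>k=0..3. l k ^ \<alpha> k) = 0"
    using assms by (intro prod_zero) (auto intro!: bexI[of _ 0])
  then show ?thesis
    by (simp add: star_integrand_def)
qed

lemma star_integrand_upper_plus:
  assumes "i \<in> {0..3}"
  shows "star_integrand l (\<alpha> + eunit i) \<gamma> = l i * star_integrand l \<alpha> \<gamma>"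
proof -
  have "(\<Prod>k=0..3. l k ^ (\<alpha> + eunit i) k) = (\<Prod>k=0..3. l k ^ \<alpha> k * (if k = i then l k else 1))"
    by (intro prod.cong) (auto simp: eunit_def)
  also have "\<dots> = (\<Prod>k=0..3. l k ^ \<alpha> k) * l i"
    using assms by (subst prod.distrib, subst prod.delta) auto
  finally show ?thesis
    by (simp add: star_integrand_def)
qed

lemma star_integrand_lower_minus:
  assumes i: "i \<in> {1..3}" and \<gamma>: "\<gamma> i \<ge> 1" and nz: "l 0 + l i \<noteq> 0"
  shows "star_integrand l \<alpha> (\<gamma> - eunit i) = (l 0 + l i) * star_integrand l \<alpha> \<gamma>"
proof -
  have "(\<Prod>k=1..3. (l 0 + l k) ^ \<gamma> k) =
      (\<Prod>k=1..3. (l 0 + l k) ^ (\<gamma> - eunit i) k * (if k = i then l 0 + l k else 1))"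
    using \<gamma> by (intro prod.cong) (auto simp: eunit_def power_eq_if mult.commute)
  also have "\<dots> = (\<Prod>k=1..3. (l 0 + l k) ^ (\<gamma> - eunit i) k) * (l 0 + l i)"
    using i by (subst prod.distrib, subst prod.delta) auto
  finally show ?thesis
    using nz by (simp add: star_integrand_def)
qed

lemma star_integrand_lower_minus2:
  assumes "i \<in> {1..3}" "j \<in> {1..3}" "i \<noteq> j" "\<gamma> i \<ge> 1" "\<gamma> j \<ge> 1"
    and "l 0 + l i \<noteq> 0" "l 0 + l j \<noteq> 0"
  shows "star_integrand l \<alpha> (\<gamma> - eunit i - eunit j) =
    (l 0 + l i) * (l 0 + l j) * star_integrand l \<alpha> \<gamma>"
proof -
  have "(\<gamma> - eunit i) j = \<gamma> j"
    using assms by (simp add: eunit_def)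
  then show ?thesis
    using assms by (simp add: star_integrand_lower_minus)
qed

lemma sum_pairs_three:
  fixes f :: "nat \<Rightarrow> nat \<Rightarrow> 'a::comm_monoid_add"
  shows "(\<Sum>i\<in>{1..3}. \<Sum>j\<in>{i<..3}. f i j) = f 1 2 + f 1 3 + f 2 3"
    and "(\<Sum>i\<in>{1..3}. \<Sum>j\<in>{1..3} - {i}. f i j) = f 1 2 + f 1 3 + f 2 1 + f 2 3 + f 3 1 + f 3 2"
proof -
  have "{1..3::nat} = {1, 2, 3}" "{1<..3::nat} = {2, 3}" "{2<..3::nat} = {3}" "{3<..3::nat} = {}"
    by auto
  moreover have "{1, 2, 3} - {1} = {2, 3 :: nat}" "{1, 2, 3} - {2} = {1, 3 :: nat}"
      "{1, 2, 3} - {3} = {1, 2 :: nat}"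
    by auto
  ultimately show "(\<Sum>i\<in>{1..3}. \<Sum>j\<in>{i<..3}. f i j) = f 1 2 + f 1 3 + f 2 3"
    and "(\<Sum>i\<in>{1..3}. \<Sum>j\<in>{1..3} - {i}. f i j) = f 1 2 + f 1 3 + f 2 1 + f 2 3 + f 3 1 + f 3 2"
    by (simp_all add: add_ac)
qed

text \<open>
  The recursion before integration. The bound \<open>\<alpha> 0 \<ge> 2\<close> leaves a positive power of \<open>l 0\<close> in every
  integrand, so that both sides vanish on the face \<open>l 0 = 0\<close>; elsewhere each integrand is a
  polynomial multiple of the one with exponents \<open>\<alpha> - eunit 0\<close> and \<open>\<gamma>\<close>.
\<close>

lemma star_integrand_relation:
  assumes l: "\<And>k. k \<in> {0..3} \<Longrightarrow> 0 \<le> l k" and sum: "(\<Sum>k=0..3. l k) = 1"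
    and \<alpha>: "\<alpha> 0 \<ge> 2" and \<gamma>: "\<And>k. k \<in> {1..3} \<Longrightarrow> \<gamma> k \<ge> 1"
  shows "star_integrand l \<alpha> \<gamma> =
      1/3 * (\<Sum>i\<in>{1..3}. \<Sum>j\<in>{i<..3}. star_integrand l (\<alpha> - eunit 0) (\<gamma> - eunit i - eunit j))
    + 1/6 * (\<Sum>i\<in>{1..3}. \<Sum>j\<in>{1..3} - {i}.
               star_integrand l (\<alpha> - eunit 0 + eunit i) (\<gamma> - eunit j))
    - 2/3 * (\<Sum>i\<in>{1..3}. \<Sum>j\<in>{i<..3}.
               star_integrand l (\<alpha> - eunit 0 + eunit i + eunit j) \<gamma>)"
proof (cases "l 0 = 0")
  case True
  have "star_integrand l \<alpha>' \<gamma>' = 0" if "\<alpha>' 0 \<ge> 1" for \<alpha>' \<gamma>'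
    using True that by (rule star_integrand_eq_0)
  then show ?thesis
    using \<alpha> by (simp add: eunit_def)
next
  case False
  define P where "P = star_integrand l (\<alpha> - eunit 0) \<gamma>"
  have s: "l 0 + l k \<noteq> 0" if "k \<in> {1..3}" for k
    using False l[of 0] l[of k] that by auto
  have F: "star_integrand l \<alpha> \<gamma> = l 0 * P"
  proof -
    have "\<alpha> = (\<alpha> - eunit 0) + eunit 0"
      using \<alpha> by (auto simp: eunit_def fun_eq_iff)
    then show ?thesis
      using star_integrand_upper_plus[of 0 l "\<alpha> - eunit 0" \<gamma>] by (simp add: P_def)
  qed
  have A: "star_integrand l (\<alpha> - eunit 0) (\<gamma> - eunit i - eunit j) = (l 0 + l i) * (l 0 + l j) * P"
    if "i \<in> {1..3}" "j \<in> {1..3}" "i \<noteq> j" for i j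
    unfolding P_def using that by (intro star_integrand_lower_minus2 \<gamma> s)
  have B: "star_integrand l (\<alpha> - eunit 0 + eunit i) (\<gamma> - eunit j) = l i * (l 0 + l j) * P"
    if "i \<in> {1..3}" "j \<in> {1..3}" for i j
    unfolding P_def using that \<gamma>[of j] s[of j]
    by (simp add: star_integrand_upper_plus star_integrand_lower_minus)
  have C: "star_integrand l (\<alpha> - eunit 0 + eunit i + eunit j) \<gamma> = l i * l j * P"
    if "i \<in> {1..3}" "j \<in> {1..3}" for i j
    unfolding P_def using that by (simp add: star_integrand_upper_plus)
  have "{0..3::nat} = {0, 1, 2, 3}"
    by auto
  then have l0: "l 0 = 1 - l 1 - l 2 - l 3"
    using sum by simp
  \<comment> \<open>Homogeneous degrees differ between the two sides; eliminating \<open>l 0\<close> makes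
      the two polynomials literally equal.\<close>
  show ?thesis
    unfolding F sum_pairs_three by (simp add: A B C) (simp add: l0 field_simps)
qed

section \<open>Bounds for the integrands on the right-hand side\<close>

text \<open>
  One of \<open>p\<close>, \<open>q\<close>, \<open>r\<close> is at least \<open>1/3\<close>, so its powers in the denominator cost only a constant.
  Of the other two, one factor each is kept in the bound, and the remaining powers are cancelled
  against powers of \<open>x\<close>, as \<open>x\<close> exceeds neither.
\<close>

lemma star_monomial_le:
  fixes x p q r :: real
  assumes x: "0 < x" and p: "x \<le> p" "p \<le> 1" and q: "x \<le> q" "q \<le> 1" and r: "x \<le> r" "r \<le> 1"
    and sum: "1 \<le> p + q + r"
  shows "x ^ (2 * n + 1) / (p ^ (n + 1) * q ^ (n + 1) * r ^ (n + 2)) \<le>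
    3 ^ (n + 2) * (1 / (p * q) + 1 / (p * r) + 1 / (q * r))"
proof -
  have inv: "1 / t ^ k \<le> 3 ^ (n + 2)" if "1/3 \<le> t" "k \<le> n + 2" for t :: real and k
  proof -
    have "1 / t ^ k = (1 / t) ^ k"
      by (simp add: power_one_over)
    also have "\<dots> \<le> 3 ^ k"
      using that by (intro power_mono) (auto simp: field_simps)
    also have "\<dots> \<le> 3 ^ (n + 2)"
      using that by (intro power_increasing) auto
    finally show ?thesis .
  qed
  have ratio: "x ^ k / t ^ k \<le> 1" if "x \<le> t" for t :: real and k
    using x that by (simp add: divide_le_eq_1 power_mono)
  have x1: "x \<le> 1"
    using p by simp
  have pos: "0 < p" "0 < q" "0 < r"
    using x p q r by auto
  \<comment> \<open>The large factor is the one with exponent \<open>n + 2\<close>: the other two absorb \<open>n\<close> powers of \<open>x\<close>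
      each, and the last one is at most \<open>1\<close>.\<close>
  have outer: "x ^ (2 * n + 1) / (a ^ (n + 1) * b ^ (n + 1) * c ^ (n + 2)) \<le> 3 ^ (n + 2) * (1 / (a * b))"
    if "x \<le> a" "x \<le> b" "1/3 \<le> c" for a b c :: real
  proof -
    have "x ^ (2 * n + 1) / (a ^ (n + 1) * b ^ (n + 1) * c ^ (n + 2)) =
        x * (x ^ n / a ^ n) * (x ^ n / b ^ n) * (1 / c ^ (n + 2)) * (1 / (a * b))"
      by (simp add: mult_2 power_add divide_simps)
    also have "\<dots> \<le> 1 * 1 * 1 * 3 ^ (n + 2) * (1 / (a * b))"
      using x x1 that by (intro mult_mono ratio inv) auto
    finally show ?thesis
      by simp
  qed
  \<comment> \<open>The large factor has exponent \<open>n + 1\<close>: now \<open>n\<close> and \<open>n + 1\<close> powers of \<open>x\<close> are absorbed,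
      which uses all of them.\<close>
  have inner: "x ^ (2 * n + 1) / (a ^ (n + 1) * b ^ (n + 1) * c ^ (n + 2)) \<le> 3 ^ (n + 2) * (1 / (b * c))"
    if "x \<le> b" "x \<le> c" "1/3 \<le> a" for a b c :: real
  proof -
    have "x ^ (2 * n + 1) / (a ^ (n + 1) * b ^ (n + 1) * c ^ (n + 2)) =
        (x ^ n / b ^ n) * (x ^ (n + 1) / c ^ (n + 1)) * (1 / a ^ (n + 1)) * (1 / (b * c))"
      by (simp add: mult_2 power_add divide_simps)
    also have "\<dots> \<le> 1 * 1 * 3 ^ (n + 2) * (1 / (b * c))"
      using x that by (intro mult_mono ratio inv) auto
    finally show ?thesis
      by simp
  qed
  have D: "1 / (p * q) \<ge> 0" "1 / (p * r) \<ge> 0" "1 / (q * r) \<ge> 0"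
    using pos by auto
  consider "1/3 \<le> p" | "1/3 \<le> q" | "1/3 \<le> r"
    using sum by linarith
  then show ?thesis
  proof cases
    case 1
    have "3 ^ (n + 2) * (1 / (q * r)) \<le> 3 ^ (n + 2) * (1 / (p * q) + 1 / (p * r) + 1 / (q * r))"
      using D by (intro mult_left_mono) auto
    then show ?thesis
      using inner[OF q(1) r(1) 1] by linarith
  next
    case 2
    have "3 ^ (n + 2) * (1 / (p * r)) \<le> 3 ^ (n + 2) * (1 / (p * q) + 1 / (p * r) + 1 / (q * r))"
      using D by (intro mult_left_mono) auto
    then show ?thesis
      using inner[OF p(1) r(1) 2] by (simp only: mult.commute[of "p ^ (n + 1)"])
  next
    case 3
    have "3 ^ (n + 2) * (1 / (p * q)) \<le> 3 ^ (n + 2) * (1 / (p * q) + 1 / (p * r) + 1 / (q * r))"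
      using D by (intro mult_left_mono) auto
    then show ?thesis
      using outer[OF p(1) q(1) 3] by linarith
  qed
qed

text \<open>
  The ratios \<open>l k / (l 0 + l k)\<close> are at most \<open>1\<close>, so \<open>\<alpha> k\<close> can be removed from numerator and
  denominator, after which the exponents of the three sums agree.
\<close>

lemma star_integrand_le_equal_powers:
  assumes l: "\<And>k. k \<in> {0..3} \<Longrightarrow> 0 \<le> l k" and l0: "0 < l 0"
    and \<gamma>: "\<And>k. k \<in> {1..3} \<Longrightarrow> \<gamma> k = \<alpha> k + m"
  shows "star_integrand l \<alpha> \<gamma> \<le> l 0 ^ \<alpha> 0 / (\<Prod>k=1..3. (l 0 + l k) ^ m)"
proof -
  have pos: "0 < l 0 + l k" if "k \<in> {1..3}" for k
    using l[of k] l0 that by auto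
  have "(\<Prod>k=0..3. l k ^ \<alpha> k) = l 0 ^ \<alpha> 0 * (\<Prod>k=1..3. l k ^ \<alpha> k)"
    by (subst prod.atLeast_Suc_atMost) auto
  moreover have "(\<Prod>k=1..3. (l 0 + l k) ^ \<gamma> k) =
      (\<Prod>k=1..3. (l 0 + l k) ^ \<alpha> k) * (\<Prod>k=1..3. (l 0 + l k) ^ m)"
    by (simp only: prod.distrib[symmetric]) (intro prod.cong, auto simp: \<gamma> power_add)
  ultimately have "star_integrand l \<alpha> \<gamma> =
      (\<Prod>k=1..3. l k ^ \<alpha> k) / (\<Prod>k=1..3. (l 0 + l k) ^ \<alpha> k) *
      (l 0 ^ \<alpha> 0 / (\<Prod>k=1..3. (l 0 + l k) ^ m))"
    by (simp add: star_integrand_def)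
  also have "\<dots> \<le> 1 * (l 0 ^ \<alpha> 0 / (\<Prod>k=1..3. (l 0 + l k) ^ m))"
  proof (intro mult_right_mono)
    have "(\<Prod>k=1..3. l k ^ \<alpha> k) \<le> (\<Prod>k=1..3. (l 0 + l k) ^ \<alpha> k)"
      using l l0 by (intro prod_mono conjI power_mono zero_le_power) auto
    moreover have "0 < (\<Prod>k=1..3. (l 0 + l k) ^ \<alpha> k)"
      using pos by (intro prod_pos) auto
    ultimately show "(\<Prod>k=1..3. l k ^ \<alpha> k) / (\<Prod>k=1..3. (l 0 + l k) ^ \<alpha> k) \<le> 1"
      by simp
    show "0 \<le> l 0 ^ \<alpha> 0 / (\<Prod>k=1..3. (l 0 + l k) ^ m)"
      using pos l0 by (intro divide_nonneg_nonneg prod_nonneg) (auto simp: less_imp_le)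
  qed
  finally show ?thesis
    by simp
qed

text \<open>
  The dominating estimate for all three kinds of moments on the right-hand side; there \<open>\<beta>\<close> is
  \<open>\<alpha> - eunit 0\<close>. The factors \<open>s i\<close> and \<open>s j\<close> reduce two of the three equal exponents \<open>n + 2\<close> by one.
\<close>

lemma star_integrand_weighted_le:
  fixes l :: "nat \<Rightarrow> real"
  defines "s \<equiv> \<lambda>k. l 0 + l k"
  assumes l: "\<And>k. k \<in> {0..3} \<Longrightarrow> 0 \<le> l k" and sum: "(\<Sum>k=0..3. l k) = 1" and l0: "0 < l 0"
    and \<beta>: "\<beta> 0 = 2 * n + 1" and \<gamma>: "\<And>k. k \<in> {1..3} \<Longrightarrow> \<gamma> k = \<beta> k + (n + 2)"
    and ij: "i \<in> {1..3}" "j \<in> {1..3}" "i \<noteq> j"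
  shows "s i * s j * star_integrand l \<beta> \<gamma> \<le>
    3 ^ (n + 2) * (1 / (s 1 * s 2) + 1 / (s 1 * s 3) + 1 / (s 2 * s 3))"
proof -
  have s: "l 0 \<le> s k" "0 < s k" if "k \<in> {1..3}" for k
    using l[of k] l0 that by (auto simp: s_def)
  have s1: "s k \<le> 1" if "k \<in> {1..3}" for k
  proof -
    have "(\<Sum>k\<in>{0, k}. l k) \<le> (\<Sum>k=0..3. l k)"
      using l that by (intro sum_mono2) auto
    then show ?thesis
      using that sum by (simp add: s_def)
  qed
  have "{0..3::nat} = {0, 1, 2, 3}" and set3: "{1..3::nat} = {1, 2, 3}"
    by auto
  then have ssum: "1 \<le> s 1 + s 2 + s 3"
    using sum l0 by (simp add: s_def)
  \<comment> \<open>In each case \<open>c\<close> is the third index, whose exponent stays at \<open>n + 2\<close>.\<close>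
  have mono: "s a * s b * (l 0 ^ (2 * n + 1) / (\<Prod>k=1..3. s k ^ (n + 2))) \<le>
      3 ^ (n + 2) * (1 / (s 1 * s 2) + 1 / (s 1 * s 3) + 1 / (s 2 * s 3))"
    if abc: "(a, b, c) \<in> {(1, 2, 3), (1, 3, 2), (2, 3, 1), (2, 1, 3), (3, 1, 2), (3, 2, 1)}" for a b c :: nat
  proof -
    have in3: "a \<in> {1..3}" "b \<in> {1..3}" "c \<in> {1..3}"
      using abc by auto
    have "(\<Prod>k=1..3. s k ^ (n + 2)) = s a ^ (n + 2) * s b ^ (n + 2) * s c ^ (n + 2)"
      using abc unfolding set3 by (auto simp: mult_ac)
    moreover have "s a \<noteq> 0" "s b \<noteq> 0" "s c \<noteq> 0"
      using s in3 by (auto simp: less_le)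
    ultimately have "s a * s b * (l 0 ^ (2 * n + 1) / (\<Prod>k=1..3. s k ^ (n + 2))) =
        l 0 ^ (2 * n + 1) / (s a ^ (n + 1) * s b ^ (n + 1) * s c ^ (n + 2))"
      by (simp add: field_simps)
    also have "\<dots> \<le> 3 ^ (n + 2) * (1 / (s a * s b) + 1 / (s a * s c) + 1 / (s b * s c))"
      using ssum abc by (intro star_monomial_le l0 s s1 in3) auto
    also have "1 / (s a * s b) + 1 / (s a * s c) + 1 / (s b * s c) =
        1 / (s 1 * s 2) + 1 / (s 1 * s 3) + 1 / (s 2 * s 3)"
      using abc by (auto simp: mult_ac add_ac)
    finally show ?thesis .
  qed
  have "star_integrand l \<beta> \<gamma> \<le> l 0 ^ (2 * n + 1) / (\<Prod>k=1..3. s k ^ (n + 2))"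
    using star_integrand_le_equal_powers[where l = l and \<alpha> = \<beta> and \<gamma> = \<gamma> and m = "n + 2", OF l l0 \<gamma>]
    unfolding \<beta> s_def by simp
  then have "s i * s j * star_integrand l \<beta> \<gamma> \<le>
      s i * s j * (l 0 ^ (2 * n + 1) / (\<Prod>k=1..3. s k ^ (n + 2)))"
    using s[OF ij(1)] s[OF ij(2)] by (intro mult_left_mono) auto
  also have "\<dots> \<le> 3 ^ (n + 2) * (1 / (s 1 * s 2) + 1 / (s 1 * s 3) + 1 / (s 2 * s 3))"
  proof (rule mono)
    have "i = 1 \<or> i = 2 \<or> i = 3" "j = 1 \<or> j = 2 \<or> j = 3"
      using ij by auto
    then show "(i, j, 6 - i - j) \<in> {(1, 2, 3), (1, 3, 2), (2, 3, 1), (2, 1, 3), (3, 1, 2), (3, 2, 1)}"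
      using ij(3) by (elim disjE) simp_all
  qed
  finally show ?thesis .
qed

text \<open>
  Away from the face \<open>l 0 = 0\<close> each integrand arises from
  \<open>(l 0 + l i) * (l 0 + l j) * star_integrand l \<beta> \<gamma>\<close> by replacing none, one or both of the sums
  by \<open>l i\<close> or \<open>l j\<close>, which can only make it smaller.
\<close>

lemma
  fixes l :: "nat \<Rightarrow> real"
  defines "D \<equiv> 1 / ((l 0 + l 1) * (l 0 + l 2)) + 1 / ((l 0 + l 1) * (l 0 + l 3)) +
    1 / ((l 0 + l 2) * (l 0 + l 3))"
  assumes l: "\<And>k. k \<in> {0..3} \<Longrightarrow> 0 \<le> l k" and sum: "(\<Sum>k=0..3. l k) = 1"
    and \<beta>: "\<beta> 0 = 2 * n + 1" and \<gamma>: "\<And>k. k \<in> {1..3} \<Longrightarrow> \<gamma> k = \<beta> k + (n + 2)"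
    and ij: "i \<in> {1..3}" "j \<in> {1..3}" "i \<noteq> j"
  shows star_integrand_bound_lower: "star_integrand l \<beta> (\<gamma> - eunit i - eunit j) \<le> 3 ^ (n + 2) * D"
    and star_integrand_bound_mixed: "star_integrand l (\<beta> + eunit i) (\<gamma> - eunit j) \<le> 3 ^ (n + 2) * D"
    and star_integrand_bound_upper: "star_integrand l (\<beta> + eunit i + eunit j) \<gamma> \<le> 3 ^ (n + 2) * D"
proof -
  let ?P = "star_integrand l \<beta> \<gamma>"
  have D: "0 \<le> 3 ^ (n + 2) * D"
    unfolding D_def using l by (intro mult_nonneg_nonneg add_nonneg_nonneg) auto
  have "star_integrand l \<beta> (\<gamma> - eunit i - eunit j) \<le> 3 ^ (n + 2) * D \<and>
      star_integrand l (\<beta> + eunit i) (\<gamma> - eunit j) \<le> 3 ^ (n + 2) * D \<and>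
      star_integrand l (\<beta> + eunit i + eunit j) \<gamma> \<le> 3 ^ (n + 2) * D"
  proof (cases "l 0 = 0")
    case True
    have "star_integrand l \<beta>' \<gamma>' = 0" if "\<beta>' 0 \<ge> 1" for \<beta>' \<gamma>'
      using True that by (rule star_integrand_eq_0)
    then show ?thesis
      using D \<beta> by simp
  next
    case False
    then have l0: "0 < l 0"
      using l[of 0] by simp
    have nz: "l 0 + l k \<noteq> 0" if "k \<in> {1..3}" for k
      using l0 l[of k] that by auto
    have \<gamma>1: "\<gamma> k \<ge> 1" if "k \<in> {1..3}" for k
      using \<gamma>[OF that] by simp
    have main: "(l 0 + l i) * (l 0 + l j) * ?P \<le> 3 ^ (n + 2) * D"
      unfolding D_def 
      by (rule star_integrand_weighted_le[where l = l and \<beta> = \<beta> and \<gamma> = \<gamma> and n = n,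
            OF l sum l0 \<beta> \<gamma> ij])
    have P: "0 \<le> ?P"
      by (rule star_integrand_nonneg[OF l])
    have "star_integrand l (\<beta> + eunit i) (\<gamma> - eunit j) = l i * (l 0 + l j) * ?P"
      using ij nz \<gamma>1 by (simp add: star_integrand_upper_plus star_integrand_lower_minus)
    also have "\<dots> \<le> (l 0 + l i) * (l 0 + l j) * ?P"
      using l ij l0 P by (intro mult_right_mono) auto
    finally have B: "star_integrand l (\<beta> + eunit i) (\<gamma> - eunit j) \<le> 3 ^ (n + 2) * D"
      using main by simp
    have "star_integrand l (\<beta> + eunit i + eunit j) \<gamma> = l i * l j * ?P"
      using ij by (simp add: star_integrand_upper_plus)
    also have "\<dots> \<le> (l 0 + l i) * (l 0 + l j) * ?P"
      using l ij l0 P by (intro mult_right_mono mult_mono) auto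
    finally have C: "star_integrand l (\<beta> + eunit i + eunit j) \<gamma> \<le> 3 ^ (n + 2) * D"
      using main by simp
    show ?thesis
      using main B C star_integrand_lower_minus2[where l = l and \<alpha> = \<beta> and \<gamma> = \<gamma>, OF ij]
        nz ij \<gamma>1 by simp
  qed
  then show "star_integrand l \<beta> (\<gamma> - eunit i - eunit j) \<le> 3 ^ (n + 2) * D"
    and "star_integrand l (\<beta> + eunit i) (\<gamma> - eunit j) \<le> 3 ^ (n + 2) * D"
    and "star_integrand l (\<beta> + eunit i + eunit j) \<gamma> \<le> 3 ^ (n + 2) * D"
    by auto
qed

section \<open>Star moments\<close>

text \<open>
  Passage from the integral in \<open>[0, \<infinity>]\<close> to a real integral, in which differences can be taken.
\<close>

lemma star_moment_eq:
  assumes v: "tetrahedron_vertices v"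
    and int: "set_integrable lborel (tetrahedron v) (\<lambda>x. star_integrand (\<lambda>k. bary v k x) \<alpha> \<gamma>)"
  shows "star_moment v \<alpha> \<gamma> < \<infinity>"
    and "enn2real (star_moment v \<alpha> \<gamma>) =
      (LINT x:tetrahedron v|lborel. star_integrand (\<lambda>k. bary v k x) \<alpha> \<gamma>) /
        measure lborel (tetrahedron v)"
proof -
  let ?T = "tetrahedron v" and ?f = "\<lambda>x. star_integrand (\<lambda>k. bary v k x) \<alpha> \<gamma>"
  have nn: "0 \<le> ?f x" if "x \<in> ?T" for x
    by (rule star_integrand_nonneg) (use that in \<open>simp add: tetrahedron_eq[OF v]\<close>)
  have "(\<integral>\<^sup>+x\<in>?T. ennreal (?f x) \<partial>lborel) = (\<integral>\<^sup>+x. ennreal (indicator ?T x *\<^sub>R ?f x) \<partial>lborel)"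
    by (intro nn_integral_cong) (simp split: split_indicator)
  also have "\<dots> = ennreal (LINT x:?T|lborel. ?f x)"
    unfolding set_lebesgue_integral_def using int nn
    by (intro nn_integral_eq_integral) (auto simp: set_integrable_def split: split_indicator)
  finally have num: "(\<integral>\<^sup>+x\<in>?T. ennreal (?f x) \<partial>lborel) = ennreal (LINT x:?T|lborel. ?f x)" .
  have I: "0 \<le> (LINT x:?T|lborel. ?f x)"
    unfolding set_lebesgue_integral_def
    by (intro integral_nonneg_AE) (auto simp: nn split: split_indicator)
  have den: "emeasure lborel ?T = ennreal (measure lborel ?T)"
    using emeasure_tetrahedron(2)[OF v] by (intro emeasure_eq_ennreal_measure) auto
  then have "0 < measure lborel ?T"
    using emeasure_tetrahedron(1)[OF v] by (auto simp: zero_less_measure_iff)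
  then have "star_moment v \<alpha> \<gamma> = ennreal ((LINT x:?T|lborel. ?f x) / measure lborel ?T)"
    using num I by (simp add: star_moment_def star_integrand_def den divide_ennreal)
  then show "star_moment v \<alpha> \<gamma> < \<infinity>"
    and "enn2real (star_moment v \<alpha> \<gamma>) = (LINT x:?T|lborel. ?f x) / measure lborel ?T"
    using I by simp_all
qed

lemma set_integrable_star_integrand:
  assumes v: "tetrahedron_vertices v"
    and le: "\<And>l. \<lbrakk>\<And>k. k \<in> {0..3} \<Longrightarrow> 0 \<le> l k; (\<Sum>k=0..3. l k) = 1\<rbrakk> \<Longrightarrow>
      star_integrand l \<alpha> \<gamma> \<le>
        C * (1 / ((l 0 + l 1) * (l 0 + l 2)) + 1 / ((l 0 + l 1) * (l 0 + l 3)) +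
             1 / ((l 0 + l 2) * (l 0 + l 3)))"
  shows "set_integrable lborel (tetrahedron v) (\<lambda>x. star_integrand (\<lambda>k. bary v k x) \<alpha> \<gamma>)"
proof (rule set_integrable_bound)
  let ?s = "\<lambda>k x. bary v 0 x + bary v k x"
  show "set_integrable lborel (tetrahedron v)
      (\<lambda>x. C * (1 / (?s 1 x * ?s 2 x) + 1 / (?s 1 x * ?s 3 x) + 1 / (?s 2 x * ?s 3 x)))"
    by (intro set_integrable_mult_right set_integral_add(1)
        integrable_tetrahedron_inverse_two_sums v) auto
  have [measurable]: "bary v k \<in> borel_measurable borel" if "k \<in> {0..3}" for k
    by (intro borel_measurable_continuous_onI continuous_on_bary v that)
  have [measurable]: "tetrahedron v \<in> sets borel"
    by (intro borel_compact compact_tetrahedron)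
  show "set_borel_measurable lborel (tetrahedron v) (\<lambda>x. star_integrand (\<lambda>k. bary v k x) \<alpha> \<gamma>)"
    unfolding set_borel_measurable_def star_integrand_def by measurable
  have "norm (star_integrand (\<lambda>k. bary v k x) \<alpha> \<gamma>) \<le>
      norm (C * (1 / (?s 1 x * ?s 2 x) + 1 / (?s 1 x * ?s 3 x) + 1 / (?s 2 x * ?s 3 x)))"
    if "x \<in> tetrahedron v" for x
  proof -
    have l: "0 \<le> bary v k x" if "k \<in> {0..3}" for k
      using \<open>x \<in> tetrahedron v\<close> that by (simp add: tetrahedron_eq[OF v])
    have nn: "0 \<le> star_integrand (\<lambda>k. bary v k x) \<alpha> \<gamma>"
      by (rule star_integrand_nonneg) (rule l)
    show ?thesis
      unfolding real_norm_def abs_of_nonneg[OF nn]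
      by (rule order_trans[OF le abs_ge_self]) (use l sum_bary[OF v] in auto)
  qed
  then show "AE x in lborel. x \<in> tetrahedron v \<longrightarrow>
      norm (star_integrand (\<lambda>k. bary v k x) \<alpha> \<gamma>) \<le>
      norm (C * (1 / (?s 1 x * ?s 2 x) + 1 / (?s 1 x * ?s 3 x) + 1 / (?s 2 x * ?s 3 x)))"
    by simp
qed

text \<open>
  Adding the two conditions that contain \<open>\<gamma> k\<close> and subtracting the third gives
  \<open>2 * \<gamma> k = \<alpha> 0 + 2 * \<alpha> k + 2\<close>, which forces \<open>\<alpha> 0\<close> to be even.
\<close>

lemma exponents_from_pair_sums:
  fixes \<alpha> \<gamma> :: "nat \<Rightarrow> nat"
  assumes \<alpha>: "\<alpha> 0 \<ge> 1"
    and pair: "\<forall>i\<in>{1..3}. \<forall>j\<in>{i<..3}. \<gamma> i + \<gamma> j = \<alpha> 0 + \<alpha> i + \<alpha> j + 2"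
  obtains n where "\<alpha> 0 = 2 * n + 2" "\<And>k. k \<in> {1..3} \<Longrightarrow> \<gamma> k = \<alpha> k + (n + 2)"
proof -
  have p: "\<gamma> 1 + \<gamma> 2 = \<alpha> 0 + \<alpha> 1 + \<alpha> 2 + 2" "\<gamma> 1 + \<gamma> 3 = \<alpha> 0 + \<alpha> 1 + \<alpha> 3 + 2"
      "\<gamma> 2 + \<gamma> 3 = \<alpha> 0 + \<alpha> 2 + \<alpha> 3 + 2"
    using pair by auto
  define n where "n = \<alpha> 0 div 2 - 1"
  have \<alpha>0: "\<alpha> 0 = 2 * n + 2"
    using p \<alpha> unfolding n_def by presburger
  moreover have "\<gamma> k = \<alpha> k + (n + 2)" if "k \<in> {1..3}" for k
  proof -
    have "k = 1 \<or> k = 2 \<or> k = 3"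
      using that by auto
    then show ?thesis
      using p \<alpha>0 by auto
  qed
  ultimately show ?thesis
    using that by blast
qed

theorem lemma4p8:
  fixes v :: "nat \<Rightarrow> real^3" and \<alpha> \<gamma> :: "nat \<Rightarrow> nat"
  assumes "tetrahedron_vertices v"
    and "star_moment v \<alpha> \<gamma> < \<infinity>"
    and "\<alpha> 0 \<ge> 1"
    and "\<forall>i\<in>{1..3}. \<forall>j\<in>{i<..3}. \<gamma> i + \<gamma> j = \<alpha> 0 + \<alpha> i + \<alpha> j + 2"
  shows "enn2real (star_moment v \<alpha> \<gamma>) =
           1/3 * (\<Sum>i\<in>{1..3}. \<Sum>j\<in>{i<..3}.
                    enn2real (star_moment v (\<alpha> - eunit 0) (\<gamma> - eunit i - eunit j)))
         + 1/6 * (\<Sum>i\<in>{1..3}. \<Sum>j\<in>{1..3} - {i}.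
                    enn2real (star_moment v (\<alpha> - eunit 0 + eunit i) (\<gamma> - eunit j)))
         - 2/3 * (\<Sum>i\<in>{1..3}. \<Sum>j\<in>{i<..3}.
                    enn2real (star_moment v (\<alpha> - eunit 0 + eunit i + eunit j) \<gamma>))
       \<and> (\<forall>i\<in>{1..3}. \<forall>j\<in>{i<..3}.
            star_moment v (\<alpha> - eunit 0) (\<gamma> - eunit i - eunit j) < \<infinity>)
       \<and> (\<forall>i\<in>{1..3}. \<forall>j\<in>{1..3} - {i}.
            star_moment v (\<alpha> - eunit 0 + eunit i) (\<gamma> - eunit j) < \<infinity>)
       \<and> (\<forall>i\<in>{1..3}. \<forall>j\<in>{i<..3}.
            star_moment v (\<alpha> - eunit 0 + eunit i + eunit j) \<gamma> < \<infinity>)"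
proof -
  note v = assms(1)
  obtain n where n: "\<alpha> 0 = 2 * n + 2" "\<And>k. k \<in> {1..3} \<Longrightarrow> \<gamma> k = \<alpha> k + (n + 2)"
    using exponents_from_pair_sums[OF assms(3,4)] by blast
  define \<beta> where "\<beta> = \<alpha> - eunit 0"
  have \<beta>: "\<beta> 0 = 2 * n + 1" "\<And>k. k \<in> {1..3} \<Longrightarrow> \<gamma> k = \<beta> k + (n + 2)"
    using n by (auto simp: \<beta>_def eunit_def)
  define f where "f = (\<lambda>\<alpha> \<gamma> x. star_integrand (\<lambda>k. bary v k x) \<alpha> \<gamma>)"
  define J where "J = (\<lambda>\<alpha> \<gamma>. LINT x:tetrahedron v|lborel. f \<alpha> \<gamma> x)"
  have A: "set_integrable lborel (tetrahedron v) (f \<beta> (\<gamma> - eunit i - eunit j))"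
    and B: "set_integrable lborel (tetrahedron v) (f (\<beta> + eunit i) (\<gamma> - eunit j))"
    and C: "set_integrable lborel (tetrahedron v) (f (\<beta> + eunit i + eunit j) \<gamma>)"
    if ij: "i \<in> {1..3}" "j \<in> {1..3}" "i \<noteq> j" for i j
  proof -
    show "set_integrable lborel (tetrahedron v) (f \<beta> (\<gamma> - eunit i - eunit j))"
      unfolding f_def
      by (rule set_integrable_star_integrand[OF v])
        (rule star_integrand_bound_lower[where \<beta> = \<beta> and \<gamma> = \<gamma> and n = n, OF _ _ \<beta> ij])
    show "set_integrable lborel (tetrahedron v) (f (\<beta> + eunit i) (\<gamma> - eunit j))"
      unfolding f_def
      by (rule set_integrable_star_integrand[OF v])
        (rule star_integrand_bound_mixed[where \<beta> = \<beta> and \<gamma> = \<gamma> and n = n, OF _ _ \<beta> ij])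
    show "set_integrable lborel (tetrahedron v) (f (\<beta> + eunit i + eunit j) \<gamma>)"
      unfolding f_def
      by (rule set_integrable_star_integrand[OF v])
        (rule star_integrand_bound_upper[where \<beta> = \<beta> and \<gamma> = \<gamma> and n = n, OF _ _ \<beta> ij])
  qed
  let ?RHS = "\<lambda>x. 1/3 * (\<Sum>i\<in>{1..3}. \<Sum>j\<in>{i<..3}. f \<beta> (\<gamma> - eunit i - eunit j) x)
    + 1/6 * (\<Sum>i\<in>{1..3}. \<Sum>j\<in>{1..3} - {i}. f (\<beta> + eunit i) (\<gamma> - eunit j) x)
    - 2/3 * (\<Sum>i\<in>{1..3}. \<Sum>j\<in>{i<..3}. f (\<beta> + eunit i + eunit j) \<gamma> x)"
  have rel: "f \<alpha> \<gamma> x = ?RHS x" if "x \<in> tetrahedron v" for x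
    unfolding f_def \<beta>_def
  proof (rule star_integrand_relation)
    show "0 \<le> bary v k x" if "k \<in> {0..3}" for k
      using \<open>x \<in> tetrahedron v\<close> that by (simp add: tetrahedron_eq[OF v])
  qed (use n sum_bary[OF v] in auto)
  have "set_integrable lborel (tetrahedron v) ?RHS"
    unfolding sum_pairs_three
    by (intro set_integral_diff(1) set_integral_add(1) set_integrable_mult_right A B C) auto
  then have F: "set_integrable lborel (tetrahedron v) (f \<alpha> \<gamma>)"
    using rel by (simp cong: set_integrable_cong)
  have "J \<alpha> \<gamma> = (LINT x:tetrahedron v|lborel. ?RHS x)"
    unfolding J_def using rel borel_compact[OF compact_tetrahedron]
    by (intro set_lebesgue_integral_cong) auto
  also have "\<dots> = 1/3 * (\<Sum>i\<in>{1..3}. \<Sum>j\<in>{i<..3}. J \<beta> (\<gamma> - eunit i - eunit j))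
    + 1/6 * (\<Sum>i\<in>{1..3}. \<Sum>j\<in>{1..3} - {i}. J (\<beta> + eunit i) (\<gamma> - eunit j))
    - 2/3 * (\<Sum>i\<in>{1..3}. \<Sum>j\<in>{i<..3}. J (\<beta> + eunit i + eunit j) \<gamma>)"
    unfolding sum_pairs_three J_def by (simp add: A B C)
  finally have J: "J \<alpha> \<gamma> = 1/3 * (\<Sum>i\<in>{1..3}. \<Sum>j\<in>{i<..3}. J \<beta> (\<gamma> - eunit i - eunit j))
    + 1/6 * (\<Sum>i\<in>{1..3}. \<Sum>j\<in>{1..3} - {i}. J (\<beta> + eunit i) (\<gamma> - eunit j))
    - 2/3 * (\<Sum>i\<in>{1..3}. \<Sum>j\<in>{i<..3}. J (\<beta> + eunit i + eunit j) \<gamma>)" .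
  have fin: "star_moment v \<alpha>' \<gamma>' < \<infinity>"
    and val: "enn2real (star_moment v \<alpha>' \<gamma>') = J \<alpha>' \<gamma>' / measure lborel (tetrahedron v)"
    if "set_integrable lborel (tetrahedron v) (f \<alpha>' \<gamma>')" for \<alpha>' \<gamma>'
    using star_moment_eq[OF v] that by (simp_all add: f_def J_def)
  have "enn2real (star_moment v \<alpha> \<gamma>) =
      1/3 * (\<Sum>i\<in>{1..3}. \<Sum>j\<in>{i<..3}. enn2real (star_moment v \<beta> (\<gamma> - eunit i - eunit j)))
    + 1/6 * (\<Sum>i\<in>{1..3}. \<Sum>j\<in>{1..3} - {i}. enn2real (star_moment v (\<beta> + eunit i) (\<gamma> - eunit j)))
    - 2/3 * (\<Sum>i\<in>{1..3}. \<Sum>j\<in>{i<..3}. enn2real (star_moment v (\<beta> + eunit i + eunit j) \<gamma>))"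
    unfolding val[OF F] J sum_pairs_three
    by (simp add: val A B C add_divide_distrib diff_divide_distrib)
  then show ?thesis
    unfolding \<beta>_def[symmetric] using fin A B C by auto
qed

end
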